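(* For any given $x\in(0,\infty)$, as $n\to\infty$, $$\mathrm{MSE}(\hat F_{n,b}^{\mathrm{LN}}(x)) = \mathrm{Var}(\hat F_{n,b}^{\mathrm{LN}}(x))+\big(\mathrm{Bias}[\hat F_{n,b}^{\mathrm{LN}}(x)]\big)^2$$ $$= n^{-1}F(x)(1-F(x)) - n^{-1}b^{1/2}\cdot\frac{x f(x)}{\sqrt{\pi}} + b^2\cdot\frac{x^2}{4}\big(f(x)+xf'(x)\big)^2+O_x(n^{-1}b)+o_x(b^2).$$ In particular, if $f(x)\cdot(f(x)+xf'(x))\neq0$, the asymptotically optimal choice of $b$, with respect to $\mathrm{MSE}$, is $$b_{\mathrm{opt}} = n^{-2/3}\left[\frac{4\cdot\frac{x^2}{4}(f(x)+xf'(x))^2}{x f(x)/\sqrt{\pi}}\right]^{-2/3},$$ with $$\mathrm{MSE}(\hat F_{n,b_{\mathrm{opt}}}^{\mathrm{LN}}(x)) = n^{-1}F(x)(1-F(x)) - n^{-4/3}\,\frac34\left[\frac{(x f(x)/\sqrt{\pi})^4}{4\cdot\frac{x^2}{4}(f(x)+xf'(x))^2}\right]^{1/3}+o_x(n^{-4/3}).$$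
   Context: $F$ is a cumulative distribution function supported on $[0,\infty)$ having two continuous and bounded derivatives; $f=F'$. $X_1,X_2,\dots$ are i.i.d. with c.d.f. $F$. The smoothing parameter $b=b_n>0$ satisfies $b\to0$ as $n\to\infty$. The lognormal kernel c.d.f. estimator is $$\hat F_{n,b}^{\mathrm{LN}}(x):=\frac1n\sum_{i=1}^n\overline K_{\mathrm{LN}}(X_i\mid\log x,\sqrt b),\qquad \overline K_{\mathrm{LN}}(t\mid\mu,\sigma):=1-\Phi\Big(\frac{\log t-\mu}{\sigma}\Big),$$ where $\Phi$ is the c.d.f. of the standard normal distribution. For an estimator $\hat F$, $\mathrm{Bias}[\hat F(x)]:=\mathbb{E}[\hat F(x)]-F(x)$ and $\mathrm{MSE}(\hat F(x)):=\mathbb{E}[(\hat F(x)-F(x))^2]$. "Asymptotically optimal choice of $b$ with respect to MSE" means the minimizer over $b>0$ of the expansion of the MSE with the error terms $O_x(n^{-1}b)$ and $o_x(b^2)$ dropped. Notation: $u=O(v)$ means $\limsup|u/v|<C<\infty$ as $n\to\infty$, where $C$ may depend on $F$ but on no other variable unless written as a subscript ($O_x$ allows dependence on $x$); $u=o(v)$ means $\lim|u/v|=0$ as $n\to\infty$, with the same rule for subscripts. *)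

theory Defs
  imports "HOL-Probability.Probability" "HOL-Library.Landau_Symbols"
begin

text \<open>
  The lognormal kernel \<open>1 - \<Phi>((log t - \<mu>) / \<sigma>)\<close>. At \<open>t = 0\<close> the convention is
  \<open>log 0 = -\<infinity>\<close>, \<open>\<Phi>(-\<infinity>) = 0\<close>, so the value is 1; this must be made explicit because
  \<^term>\<open>ln (0::real)\<close> is 0. Negative \<open>t\<close> do not occur for observations supported on \<open>[0, \<infinity>)\<close>
  (almost surely).
\<close>
definition K_LN :: "real \<Rightarrow> real \<Rightarrow> real \<Rightarrow> real" where
  "K_LN t \<mu> \<sigma> = (if t > 0 then 1 - cdf std_normal_distribution ((ln t - \<mu>) / \<sigma>) else 1)"

definition F_hat_LN :: "(nat \<Rightarrow> 'a \<Rightarrow> real) \<Rightarrow> nat \<Rightarrow> real \<Rightarrow> real \<Rightarrow> 'a \<Rightarrow> real" where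
  "F_hat_LN X n b x \<omega> = 1 / real n * (\<Sum>i=1..n. K_LN (X i \<omega>) (ln x) (sqrt b))"

definition Bias :: "'a measure \<Rightarrow> ('a \<Rightarrow> real) \<Rightarrow> real \<Rightarrow> real" where
  "Bias M Y \<theta> = prob_space.expectation M Y - \<theta>"

definition MSE :: "'a measure \<Rightarrow> ('a \<Rightarrow> real) \<Rightarrow> real \<Rightarrow> real" where
  "MSE M Y \<theta> = prob_space.expectation M (\<lambda>\<omega>. (Y \<omega> - \<theta>)\<^sup>2)"

text \<open>
  The expansion of the MSE with its error terms dropped; \<open>f\<close> and \<open>f'\<close> stand for the first and
  second derivative of the c.d.f. \<open>F\<close>.
\<close>
definition AMSE_LN ::
  "(real \<Rightarrow> real) \<Rightarrow> (real \<Rightarrow> real) \<Rightarrow> (real \<Rightarrow> real) \<Rightarrow> real \<Rightarrow> nat \<Rightarrow> real \<Rightarrow> real" where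
  "AMSE_LN F f f' x n b =
     1 / real n * (F x * (1 - F x))
     - 1 / real n * sqrt b * (x * f x / sqrt pi)
     + b\<^sup>2 * (x\<^sup>2 / 4 * (f x + x * f' x)\<^sup>2)"

definition b_opt_LN ::
  "(real \<Rightarrow> real) \<Rightarrow> (real \<Rightarrow> real) \<Rightarrow> real \<Rightarrow> nat \<Rightarrow> real" where
  "b_opt_LN f f' x n =
     real n powr (- 2 / 3)
     * ((4 * (x\<^sup>2 / 4 * (f x + x * f' x)\<^sup>2)) / (x * f x / sqrt pi)) powr (- 2 / 3)"

end

theory Submission
  imports Defs
begin

text \<open>
  For \<open>b > 0\<close> and a standard normal \<open>Z\<close>, the kernel is \<open>K_LN t (ln x) (sqrt b) = P (t < x * exp (sqrt b * Z))\<close>,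
  and its square is the same probability with \<open>Z\<close> replaced by the minimum of two independent copies
  \<open>Z\<^sub>1\<close>, \<open>Z\<^sub>2\<close>. By Fubini the first two moments of the kernel at an observation are thus the
  expectations of \<open>h (sqrt b * Z)\<close> and \<open>h (sqrt b * min Z\<^sub>1 Z\<^sub>2)\<close>, where \<open>h u = F (x * exp u)\<close>.
  Since \<open>F\<close> is bounded, the remainder \<open>(h u - h 0 - h' 0 * u) / u\<^sup>2\<close> is bounded on the whole line, so the
  expansions follow from \<open>E (min Z\<^sub>1 Z\<^sub>2) = - 1 / sqrt pi\<close> and, for the leading bias term, dominated
  convergence. The optimal \<open>b\<close> is found by substituting \<open>s = sqrt b\<close> and completing a square.
\<close>

section \<open>Taylor expansion at 0 with a quadratic remainder bound on the whole line\<close>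

text \<open>L'Hopital is applied once: the quotient of the derivatives is half the difference
  quotient of \<open>h'\<close> at 0, and the limit of the latter is \<open>c\<close> by definition
  of the derivative.\<close>

lemma second_order_expansion:
  fixes h h' :: "real \<Rightarrow> real"
  assumes D1: "eventually (\<lambda>u. (h has_real_derivative h' u) (at u)) (nhds 0)"
    and D2: "(h' has_real_derivative c) (at 0)"
  shows "((\<lambda>u. (h u - h 0 - h' 0 * u) / u\<^sup>2) \<longlongrightarrow> c / 2) (at 0)"
proof (rule lhopital[where f' = "\<lambda>u. h' u - h' 0" and g' = "\<lambda>u. 2 * u"])
  have "isCont h 0"
    using eventually_nhds_x_imp_x[OF D1] DERIV_isCont by blast
  then show "((\<lambda>u. h u - h 0 - h' 0 * u) \<longlongrightarrow> 0) (at 0)"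
    unfolding isCont_def by (auto intro!: tendsto_eq_intros)
  show "((\<lambda>u::real. u\<^sup>2) \<longlongrightarrow> 0) (at 0)"
    by (auto intro!: tendsto_eq_intros)
  show "\<forall>\<^sub>F u in at 0. u\<^sup>2 \<noteq> (0::real)" "\<forall>\<^sub>F u in at 0. 2 * u \<noteq> (0::real)"
    by (auto simp: eventually_at_filter)
  show "\<forall>\<^sub>F u in at 0. ((\<lambda>u. h u - h 0 - h' 0 * u) has_real_derivative h' u - h' 0) (at u)"
    using eventually_nhds_conv_at[THEN iffD1, OF D1, THEN conjunct1]
    by eventually_elim (auto intro!: derivative_eq_intros)
  show "\<forall>\<^sub>F u in at 0. ((\<lambda>u::real. u\<^sup>2) has_real_derivative 2 * u) (at u)"
    by (auto intro!: always_eventually derivative_eq_intros)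
  have "((\<lambda>u. (h' u - h' 0) / u) \<longlongrightarrow> c) (at 0)"
    using D2 by (simp add: has_field_derivative_iff)
  from tendsto_divide[OF this tendsto_const[of 2]]
  show "((\<lambda>u. (h' u - h' 0) / (2 * u)) \<longlongrightarrow> c / 2) (at 0)"
    by (simp add: mult.commute)
qed

text \<open>Near 0 the limit controls the quotient; at distance at least \<open>d\<close> from 0 the
  numerator grows at most linearly, hence is dominated by a multiple of \<open>u\<^sup>2\<close>.
  The single constant \<open>B\<close> later yields both the error bounds and an integrable
  majorant.\<close>

lemma bounded_quadratic_remainder:
  fixes h :: "real \<Rightarrow> real"
  assumes lim: "((\<lambda>u. (h u - h 0 - a * u) / u\<^sup>2) \<longlongrightarrow> c) (at 0)"
    and bdd: "\<And>u. \<bar>h u\<bar> \<le> K"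
  obtains B where "\<And>u. \<bar>h u - h 0 - a * u\<bar> \<le> B * u\<^sup>2"
proof -
  have "\<forall>\<^sub>F u in at 0. \<bar>(h u - h 0 - a * u) / u\<^sup>2\<bar> < \<bar>c\<bar> + 1"
    using tendsto_rabs[OF lim] by (rule order_tendstoD) simp
  then obtain d where d: "d > 0"
    "\<And>u. u \<noteq> 0 \<Longrightarrow> \<bar>u\<bar> < d \<Longrightarrow> \<bar>(h u - h 0 - a * u) / u\<^sup>2\<bar> < \<bar>c\<bar> + 1"
    unfolding eventually_at by (auto simp: dist_real_def)
  \<comment> \<open>The first summand serves \<open>\<bar>u\<bar> < d\<close>. The other two serve
    \<open>\<bar>u\<bar> \<ge> d\<close>, where \<open>1 \<le> u\<^sup>2 / d\<^sup>2\<close> absorbs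
    \<open>2 * K\<close> and \<open>\<bar>u\<bar> \<le> u\<^sup>2 / d\<close> absorbs the linear
    term.\<close>
  define B where "B = \<bar>c\<bar> + 1 + 2 * K / d\<^sup>2 + \<bar>a\<bar> / d"
  have K: "K \<ge> 0" using bdd[of 0] by linarith
  have Bc: "B \<ge> \<bar>c\<bar> + 1" using K d(1) by (simp add: B_def)
  have "\<bar>h u - h 0 - a * u\<bar> \<le> B * u\<^sup>2" for u
  proof (cases "u = 0")
    case False
    then have u2: "u\<^sup>2 > 0" by simp
    show ?thesis
    proof (cases "\<bar>u\<bar> < d")
      case True
      then have "\<bar>h u - h 0 - a * u\<bar> < (\<bar>c\<bar> + 1) * u\<^sup>2"
        using d(2)[OF False True] u2 by (simp add: abs_divide pos_divide_less_eq)
      then show ?thesis using mult_right_mono[OF Bc, of "u\<^sup>2"] by simp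
    next
      case far: False
      have "d\<^sup>2 \<le> u\<^sup>2" using far d(1) by (simp add: abs_le_square_iff[symmetric])
      then have "2 * K \<le> 2 * K / d\<^sup>2 * u\<^sup>2"
        using K d(1) by (simp add: field_simps mult_left_mono)
      moreover have "\<bar>a\<bar> * \<bar>u\<bar> \<le> \<bar>a\<bar> / d * u\<^sup>2"
      proof -
        have "d * \<bar>u\<bar> \<le> \<bar>u\<bar> * \<bar>u\<bar>" using far by (intro mult_right_mono) auto
        then have "\<bar>a\<bar> * (d * \<bar>u\<bar>) \<le> \<bar>a\<bar> * u\<^sup>2"
          by (intro mult_left_mono) (auto simp: power2_eq_square)
        then show ?thesis using d(1) by (simp add: field_simps)
      qed
      moreover have "\<bar>h u - h 0 - a * u\<bar> \<le> 2 * K + \<bar>a\<bar> * \<bar>u\<bar>"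
        using bdd[of u] bdd[of 0] by (simp add: abs_mult[symmetric])
      moreover have "(\<bar>c\<bar> + 1) * u\<^sup>2 \<ge> 0" by simp
      moreover have "B * u\<^sup>2 = (\<bar>c\<bar> + 1) * u\<^sup>2 + 2 * K / d\<^sup>2 * u\<^sup>2 + \<bar>a\<bar> / d * u\<^sup>2"
        by (simp only: B_def distrib_right)
      ultimately show ?thesis by linarith
    qed
  qed simp
  then show thesis using that by blast
qed

section \<open>Expectations of a function of a small multiple of a random variable\<close>

context prob_space
begin

lemma integrable_quadratic_bound:
  fixes h :: "real \<Rightarrow> real"
  assumes [measurable]: "random_variable borel W" "h \<in> borel_measurable borel"
    and W2: "integrable M (\<lambda>\<omega>. (W \<omega>)\<^sup>2)"
    and bound: "\<And>u. \<bar>h u - h0 - a * u\<bar> \<le> B * u\<^sup>2"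
  shows "integrable M (\<lambda>\<omega>. h (s * W \<omega>) - h0 - a * (s * W \<omega>))"
  by (rule Bochner_Integration.integrable_bound[where f = "\<lambda>\<omega>. (B * s\<^sup>2) * (W \<omega>)\<^sup>2"])
     (auto simp: W2 intro!: AE_I2 order.trans[OF bound] simp: power_mult_distrib)

text \<open>The affine part integrates exactly, which leaves the expectation of the remainder,
  bounded pointwise by \<open>B * s\<^sup>2 * (W \<omega>)\<^sup>2\<close>. Integrability of
  \<open>h (s * W \<omega>)\<close> is obtained by adding the affine part back to the integrable
  remainder.\<close>

lemma expectation_small_scale:
  fixes h :: "real \<Rightarrow> real"
  assumes W[measurable]: "random_variable borel W" and h[measurable]: "h \<in> borel_measurable borel"
    and W2: "integrable M (\<lambda>\<omega>. (W \<omega>)\<^sup>2)"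
    and bound: "\<And>u. \<bar>h u - h0 - a * u\<bar> \<le> B * u\<^sup>2"
  shows "expectation (\<lambda>\<omega>. h (s * W \<omega>)) - h0 - a * s * expectation W
           = expectation (\<lambda>\<omega>. h (s * W \<omega>) - h0 - a * (s * W \<omega>))" (is ?eq)
    and "\<bar>expectation (\<lambda>\<omega>. h (s * W \<omega>)) - h0 - a * s * expectation W\<bar>
           \<le> B * s\<^sup>2 * expectation (\<lambda>\<omega>. (W \<omega>)\<^sup>2)"
proof -
  note rem = integrable_quadratic_bound[OF W h W2 bound, of s]
  have W1: "integrable M W"
    using square_integrable_imp_integrable[OF W W2] .
  have "integrable M (\<lambda>\<omega>. (h (s * W \<omega>) - h0 - a * (s * W \<omega>)) + (h0 + a * (s * W \<omega>)))"
    by (rule Bochner_Integration.integrable_add[OF rem]) (simp add: W1)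
  then have hW: "integrable M (\<lambda>\<omega>. h (s * W \<omega>))" by simp
  show eq: ?eq
    using hW W1 by (simp add: prob_space)
  have "\<bar>expectation (\<lambda>\<omega>. h (s * W \<omega>) - h0 - a * (s * W \<omega>))\<bar>
      \<le> expectation (\<lambda>\<omega>. \<bar>h (s * W \<omega>) - h0 - a * (s * W \<omega>)\<bar>)"
    by (rule integral_abs_bound)
  also have "\<dots> \<le> expectation (\<lambda>\<omega>. B * s\<^sup>2 * (W \<omega>)\<^sup>2)"
    using rem W2 bound[of "s * W _"]
    by (intro integral_mono) (auto simp: power_mult_distrib mult.assoc)
  also have "\<dots> = B * s\<^sup>2 * expectation (\<lambda>\<omega>. (W \<omega>)\<^sup>2)" by simp
  finally show "\<bar>expectation (\<lambda>\<omega>. h (s * W \<omega>)) - h0 - a * s * expectation W\<bar>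
      \<le> B * s\<^sup>2 * expectation (\<lambda>\<omega>. (W \<omega>)\<^sup>2)" by (simp only: eq)
qed

text \<open>Dominated convergence along an arbitrary sequence of scales: the remainder divided by
  \<open>(s i)\<^sup>2\<close> is at most \<open>B * (W \<omega>)\<^sup>2\<close> and tends
  pointwise to \<open>c * (W \<omega>)\<^sup>2\<close>.\<close>

lemma expectation_small_scale_limit:
  fixes h :: "real \<Rightarrow> real"
  assumes W[measurable]: "random_variable borel W" and h[measurable]: "h \<in> borel_measurable borel"
    and W2: "integrable M (\<lambda>\<omega>. (W \<omega>)\<^sup>2)"
    and bound: "\<And>u. \<bar>h u - h0 - a * u\<bar> \<le> B * u\<^sup>2"
    and lim: "((\<lambda>u. (h u - h0 - a * u) / u\<^sup>2) \<longlongrightarrow> c) (at 0)"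
  shows "((\<lambda>s. (expectation (\<lambda>\<omega>. h (s * W \<omega>)) - h0 - a * s * expectation W) / s\<^sup>2)
           \<longlongrightarrow> c * expectation (\<lambda>\<omega>. (W \<omega>)\<^sup>2)) (at 0)"
  unfolding tendsto_at_iff_sequentially
proof (intro allI impI)
  fix s :: "nat \<Rightarrow> real"
  assume s: "\<forall>i. s i \<in> UNIV - {0}" "s \<longlonglongrightarrow> 0"
  let ?r = "\<lambda>i \<omega>. (h (s i * W \<omega>) - h0 - a * (s i * W \<omega>)) / (s i)\<^sup>2"
  have "(\<lambda>i. expectation (?r i)) \<longlonglongrightarrow> expectation (\<lambda>\<omega>. c * (W \<omega>)\<^sup>2)"
  proof (rule integral_dominated_convergence[where w = "\<lambda>\<omega>. B * (W \<omega>)\<^sup>2"])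
    show "integrable M (\<lambda>\<omega>. B * (W \<omega>)\<^sup>2)" using W2 by simp
    show "AE \<omega> in M. norm (?r i \<omega>) \<le> B * (W \<omega>)\<^sup>2" for i
      using bound[of "s i * W _"] s(1)
      by (intro AE_I2) (auto simp: abs_divide pos_divide_le_eq power_mult_distrib ac_simps)
    show "AE \<omega> in M. (\<lambda>i. ?r i \<omega>) \<longlonglongrightarrow> c * (W \<omega>)\<^sup>2"
    proof (intro AE_I2)
      fix \<omega>
      show "(\<lambda>i. ?r i \<omega>) \<longlonglongrightarrow> c * (W \<omega>)\<^sup>2"
      proof (cases "W \<omega> = 0")
        \<comment> \<open>Here the argument stays at 0, a point the punctured limit does not cover;
          the bound at 0 forces \<open>h 0 = h0\<close>, so the quotient is constantly 0.\<close>
        case True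
        then show ?thesis using bound[of 0] by simp
      next
        case False
        have "filterlim (\<lambda>i. s i * W \<omega>) (at 0) sequentially"
          unfolding filterlim_at using s False
          by (auto intro!: tendsto_eq_intros)
        from filterlim_compose[OF lim this]
        have "(\<lambda>i. (h (s i * W \<omega>) - h0 - a * (s i * W \<omega>)) / (s i * W \<omega>)\<^sup>2 * (W \<omega>)\<^sup>2)
                \<longlonglongrightarrow> c * (W \<omega>)\<^sup>2"
          by (rule tendsto_mult_right)
        then show ?thesis using False by (simp add: power_mult_distrib)
      qed
    qed
  qed simp_all
  moreover have "expectation (?r i)
      = (expectation (\<lambda>\<omega>. h (s i * W \<omega>)) - h0 - a * s i * expectation W) / (s i)\<^sup>2" for i
    unfolding expectation_small_scale(1)[OF W h W2 bound] by simp
  ultimately show "((\<lambda>s. (expectation (\<lambda>\<omega>. h (s * W \<omega>)) - h0 - a * s * expectation W) / s\<^sup>2) \<circ> s)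
      \<longlonglongrightarrow> c * expectation (\<lambda>\<omega>. (W \<omega>)\<^sup>2)"
    unfolding o_def by (simp only: integral_mult_right_zero)
qed

section \<open>Variance of sums of independent variables\<close>

lemma variance_add_indep:
  fixes X Y :: "'a \<Rightarrow> real"
  assumes ind: "indep_var borel X borel Y"
    and X2: "integrable M (\<lambda>\<omega>. (X \<omega>)\<^sup>2)" and Y2: "integrable M (\<lambda>\<omega>. (Y \<omega>)\<^sup>2)"
  shows "variance (\<lambda>\<omega>. X \<omega> + Y \<omega>) = variance X + variance Y"
proof -
  have rv: "random_variable borel X" "random_variable borel Y"
    using indep_var_rv1[OF ind] indep_var_rv2[OF ind] by auto
  have int: "integrable M X" "integrable M Y"
    using square_integrable_imp_integrable rv X2 Y2 by auto
  note prod = indep_var_lebesgue_integral[OF ind int] indep_var_integrable[OF ind int]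
  have "integrable M (\<lambda>\<omega>. (X \<omega> + Y \<omega>)\<^sup>2)"
    by (auto simp: power2_sum mult.assoc X2 Y2 prod)
  with int have "variance (\<lambda>\<omega>. X \<omega> + Y \<omega>)
      = expectation (\<lambda>\<omega>. (X \<omega> + Y \<omega>)\<^sup>2) - (expectation (\<lambda>\<omega>. X \<omega> + Y \<omega>))\<^sup>2"
    by (intro variance_eq) auto
  then show ?thesis
    using int X2 Y2 prod
    by (simp add: variance_eq power2_sum mult.assoc)
qed

text \<open>Square integrability of the partial sum is carried through the induction because
  \<open>variance_add_indep\<close> asks for it at each step.\<close>

lemma variance_sum_indep:
  fixes Y :: "'i \<Rightarrow> 'a \<Rightarrow> real"
  assumes "finite I" "indep_vars (\<lambda>_. borel) Y I"
    and "\<And>i. i \<in> I \<Longrightarrow> integrable M (\<lambda>\<omega>. (Y i \<omega>)\<^sup>2)"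
  shows "integrable M (\<lambda>\<omega>. (\<Sum>i\<in>I. Y i \<omega>)\<^sup>2) \<and>
    variance (\<lambda>\<omega>. \<Sum>i\<in>I. Y i \<omega>) = (\<Sum>i\<in>I. variance (Y i))"
  using assms
proof (induction I)
  case (insert i I)
  have IH: "integrable M (\<lambda>\<omega>. (\<Sum>i\<in>I. Y i \<omega>)\<^sup>2)"
      "variance (\<lambda>\<omega>. \<Sum>i\<in>I. Y i \<omega>) = (\<Sum>i\<in>I. variance (Y i))"
    using insert.IH indep_vars_subset[OF insert.prems(1)] insert.prems(2) by blast+
  have ind: "indep_var borel (Y i) borel (\<lambda>\<omega>. \<Sum>i\<in>I. Y i \<omega>)"
    using insert by (intro indep_vars_sum) auto
  have Yi: "integrable M (\<lambda>\<omega>. (Y i \<omega>)\<^sup>2)" using insert by simp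
  have rv: "random_variable borel (Y i)" "random_variable borel (\<lambda>\<omega>. \<Sum>i\<in>I. Y i \<omega>)"
    using indep_var_rv1[OF ind] indep_var_rv2[OF ind] by auto
  have int: "integrable M (Y i)" "integrable M (\<lambda>\<omega>. \<Sum>i\<in>I. Y i \<omega>)"
    using square_integrable_imp_integrable rv Yi IH(1) by auto
  have "integrable M (\<lambda>\<omega>. (Y i \<omega> + (\<Sum>i\<in>I. Y i \<omega>))\<^sup>2)"
    using Yi IH(1) indep_var_integrable[OF ind int] by (simp add: power2_sum mult.assoc)
  then show ?case
    using variance_add_indep[OF ind Yi IH(1)] IH(2) insert.hyps by simp
qed simp

end

section \<open>The minimum of two independent standard normal variables\<close>

abbreviation (input) "std_normal_pair \<equiv> std_normal_distribution \<Otimes>\<^sub>M std_normal_distribution"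

lemma pair_prob_space_std_normal: "pair_prob_space std_normal_distribution std_normal_distribution"
proof -
  interpret prob_space std_normal_distribution
    by (rule prob_space_normal_density) simp
  show ?thesis ..
qed

lemma distr_fst_std_normal: "distr std_normal_pair std_normal_distribution fst = std_normal_distribution"
proof -
  interpret N: prob_space std_normal_distribution
    by (rule prob_space_normal_density) simp
  show ?thesis by (rule N.distr_pair_fst)
qed

text \<open>The pair measure is invariant under swapping the coordinates, which turns the second
  projection into the first.\<close>

lemma distr_snd_std_normal: "distr std_normal_pair std_normal_distribution snd = std_normal_distribution"
proof -
  interpret P: pair_prob_space std_normal_distribution std_normal_distribution
    by (rule pair_prob_space_std_normal)
  have "distr std_normal_pair std_normal_distribution snd
      = distr (distr std_normal_pair std_normal_pair (\<lambda>(x, y). (y, x))) std_normal_distribution snd"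
    by (subst P.distr_pair_swap) (rule refl)
  also have "\<dots> = distr std_normal_pair std_normal_distribution (snd \<circ> (\<lambda>(x, y). (y, x)))"
    by (rule distr_distr) (rule measurable_snd, rule measurable_pair_swap')
  also have "snd \<circ> (\<lambda>(x::real, y). (y, x::real)) = fst"
    by auto
  finally show ?thesis using distr_fst_std_normal by (rule trans)
qed

lemma integral_std_normal_pair:
  fixes g :: "real \<Rightarrow> real"
  assumes g: "integrable std_normal_distribution g"
  shows "integrable std_normal_pair (\<lambda>z. g (fst z))" "integrable std_normal_pair (\<lambda>z. g (snd z))"
    and "(\<integral>z. g (fst z) \<partial>std_normal_pair) = (\<integral>z. g z \<partial>std_normal_distribution)"
    and "(\<integral>z. g (snd z) \<partial>std_normal_pair) = (\<integral>z. g z \<partial>std_normal_distribution)"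
proof -
  show "integrable std_normal_pair (\<lambda>z. g (fst z))"
    by (rule integrable_distr[of fst std_normal_pair std_normal_distribution])
      (rule measurable_fst, simp only: distr_fst_std_normal g)
  show "integrable std_normal_pair (\<lambda>z. g (snd z))"
    by (rule integrable_distr[of snd std_normal_pair std_normal_distribution])
      (rule measurable_snd, simp only: distr_snd_std_normal g)
  show "(\<integral>z. g (fst z) \<partial>std_normal_pair) = (\<integral>z. g z \<partial>std_normal_distribution)"
    using integral_distr[OF measurable_fst[of std_normal_distribution std_normal_distribution] borel_measurable_integrable[OF g]]
    by (simp only: distr_fst_std_normal)
  show "(\<integral>z. g (snd z) \<partial>std_normal_pair) = (\<integral>z. g z \<partial>std_normal_distribution)"
    using integral_distr[OF measurable_snd[of std_normal_distribution std_normal_distribution] borel_measurable_integrable[OF g]]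
    by (simp only: distr_snd_std_normal)
qed

text \<open>The square of the minimum is one of the two squares, hence at most their sum.\<close>

lemma min_std_normal_integrable_square: "integrable std_normal_pair (\<lambda>(u, v). (min u v)\<^sup>2)"
proof -
  have "integrable std_normal_pair (\<lambda>z. (fst z)\<^sup>2 + (snd z)\<^sup>2)"
    by (intro Bochner_Integration.integrable_add integral_std_normal_pair(1,2)
        integrable_std_normal_distribution_moment)
  then show ?thesis
    by (rule Bochner_Integration.integrable_bound) (auto simp: min_def intro!: AE_I2)
qed

text \<open>Since \<open>min u v\<close> is half of \<open>u + v - \<bar>u - v\<bar>\<close> and the
  coordinates are centred, only the absolute difference contributes. The difference is normal with
  standard deviation \<open>sqrt 2\<close>, so its first absolute moment is
  \<open>2 / sqrt pi\<close>.\<close>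

lemma expectation_min_std_normal: "(\<integral>(u, v). min u v \<partial>std_normal_pair) = - 1 / sqrt pi"
proof -
  interpret P: pair_prob_space std_normal_distribution std_normal_distribution
    by (rule pair_prob_space_std_normal)
  let ?N = std_normal_distribution
  have id: "integrable ?N (\<lambda>z. z)" "(\<integral>z. z \<partial>?N) = 0"
    using integrable_std_normal_distribution_moment[of 1]
      integral_std_normal_distribution_moment_odd[of 1] by simp_all
  note d = distr_fst_std_normal distr_snd_std_normal
  \<comment> \<open>Only the sets of the target measure matter for \<open>distr\<close>.
    Independence is phrased over \<open>borel\<close> and densities over \<open>lborel\<close>, so
    the marginal laws are needed in both versions.\<close>
  have L: "distr std_normal_pair L p = distr std_normal_pair ?N p" if "sets L = sets borel" for L p
    using that by (intro distr_cong) simp_all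
  have db: "distr std_normal_pair borel fst = ?N" "distr std_normal_pair borel snd = ?N"
    using L[of borel] d by simp_all
  have dl: "distr std_normal_pair lborel fst = ?N" "distr std_normal_pair lborel snd = ?N"
    using L[of lborel] d by simp_all
  \<comment> \<open>The joint law of the two projections is the law of the identity, that is, the
    pair measure itself; this is independence of the projections.\<close>
  have "sets std_normal_pair = sets (borel \<Otimes>\<^sub>M borel)"
    by (intro sets_pair_measure_cong) simp_all
  then have "std_normal_pair = distr std_normal_pair (borel \<Otimes>\<^sub>M borel) (\<lambda>z. (fst z, snd z))"
    by (simp add: distr_id2)
  then have ind: "P.indep_var borel fst borel snd"
    unfolding P.indep_var_distribution_eq db by simp
  have "distributed std_normal_pair lborel fst std_normal_density" "distributed std_normal_pair lborel snd std_normal_density"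
    unfolding distributed_def dl by auto
  from P.diff_indep_normal[OF ind _ _ this]
  have "distributed std_normal_pair lborel (\<lambda>z. fst z - snd z) (normal_density 0 (sqrt 2))" by simp
  from distributed_integral[OF this, of abs]
  have "(\<integral>z. \<bar>fst z - snd z\<bar> \<partial>std_normal_pair) = (\<integral>y. normal_density 0 (sqrt 2) y * \<bar>y\<bar> \<partial>lborel)"
    by simp
  also have "\<dots> = 2 / sqrt pi"
    using integral_normal_moment_abs_odd[of "sqrt 2" 0 0]
    by (simp add: real_sqrt_divide)
  finally have abs: "(\<integral>z. \<bar>fst z - snd z\<bar> \<partial>std_normal_pair) = 2 / sqrt pi" .
  have "(\<integral>(u, v). min u v \<partial>std_normal_pair) = (\<integral>z. (fst z + snd z - \<bar>fst z - snd z\<bar>) / 2 \<partial>std_normal_pair)"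
    by (intro Bochner_Integration.integral_cong) (auto simp: min_def)
  also have "\<dots> = - 1 / sqrt pi"
    using integral_std_normal_pair[OF id(1)] id(2) abs by simp
  finally show ?thesis .
qed

section \<open>Fubini and the kernel as a Gaussian probability\<close>

text \<open>Both sides are the product measure of the region \<open>fst p < W (snd p)\<close>,
  integrated in either order. The inner integral over \<open>t\<close> is the mass of the open
  half-line below \<open>W \<omega>\<close>; continuity of the cdf there excludes an atom, so this
  mass is the cdf value.\<close>

lemma integral_tail_prob_eq_integral_cdf:
  fixes D :: "real measure" and Q :: "'b measure" and W :: "'b \<Rightarrow> real"
  assumes "real_distribution D" and "prob_space Q" and [measurable]: "W \<in> borel_measurable Q"
    and cont: "\<And>\<omega>. \<omega> \<in> space Q \<Longrightarrow> isCont (cdf D) (W \<omega>)"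
  shows "(\<integral>t. measure Q {\<omega> \<in> space Q. t < W \<omega>} \<partial>D) = (\<integral>\<omega>. cdf D (W \<omega>) \<partial>Q)"
proof -
  interpret D: real_distribution D by fact
  interpret Q: prob_space Q by fact
  interpret P: pair_prob_space D Q ..
  let ?g = "\<lambda>t \<omega>. indicator {p. fst p < W (snd p)} (t, \<omega>) :: real"
  have "integrable (D \<Otimes>\<^sub>M Q) (case_prod ?g)"
    by (rule P.integrable_const_bound[of _ 1]) auto
  from P.Fubini_integral[OF this]
  have "(\<integral>t. (\<integral>\<omega>. ?g t \<omega> \<partial>Q) \<partial>D) = (\<integral>\<omega>. (\<integral>t. ?g t \<omega> \<partial>D) \<partial>Q)" ..
  moreover have "(\<integral>\<omega>. ?g t \<omega> \<partial>Q) = measure Q {\<omega> \<in> space Q. t < W \<omega>}" for t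
  proof -
    have "(\<integral>\<omega>. ?g t \<omega> \<partial>Q) = (\<integral>\<omega>. indicator {\<omega> \<in> space Q. t < W \<omega>} \<omega> \<partial>Q)"
      by (intro Bochner_Integration.integral_cong) (auto simp: indicator_def)
    then show ?thesis by simp
  qed
  moreover have "(\<integral>t. ?g t \<omega> \<partial>D) = cdf D (W \<omega>)" if "\<omega> \<in> space Q" for \<omega>
  proof -
    have "(\<integral>t. ?g t \<omega> \<partial>D) = (\<integral>t. indicator {..<W \<omega>} t \<partial>D)"
      by (intro Bochner_Integration.integral_cong) (auto simp: indicator_def)
    also have "\<dots> = measure D {..<W \<omega>}" by simp
    also have "\<dots> = measure D {..W \<omega>}"
      using cont[OF that] D.finite_measure_Union[of "{..<W \<omega>}" "{W \<omega>}"]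
      by (simp only: ivl_disj_un_singleton(2)) (simp add: D.isCont_cdf)
    finally show ?thesis by (simp add: cdf_def2)
  qed
  ultimately show ?thesis by (simp cong: Bochner_Integration.integral_cong)
qed

text \<open>For \<open>t > 0\<close>, taking logarithms turns the event into a Gaussian upper tail.
  For \<open>t \<le> 0\<close> the event is certain, which agrees with the value 1 that
  \<open>K_LN\<close> takes there.\<close>

lemma K_LN_eq_prob:
  assumes "x > 0" "b > 0"
  shows "K_LN t (ln x) (sqrt b)
    = measure std_normal_distribution {z \<in> space std_normal_distribution. t < x * exp (sqrt b * z)}"
proof (cases "t > 0")
  case True
  interpret N: real_distribution std_normal_distribution by (rule real_dist_normal_dist)
  define s where "s = (ln t - ln x) / sqrt b"
  have "t < x * exp (sqrt b * z) \<longleftrightarrow> s < z" for z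
  proof -
    have "t < x * exp (sqrt b * z) \<longleftrightarrow> ln t < ln (x * exp (sqrt b * z))"
      using True assms(1) by (intro ln_less_cancel_iff[symmetric]) auto
    also have "ln (x * exp (sqrt b * z)) = ln x + sqrt b * z"
      using assms(1) by (subst ln_mult) auto
    also have "ln t < ln x + sqrt b * z \<longleftrightarrow> ln t - ln x < z * sqrt b"
      by (auto simp: mult.commute)
    also have "\<dots> \<longleftrightarrow> s < z"
      using assms(2) unfolding s_def by (intro pos_divide_less_eq[symmetric]) simp
    finally show ?thesis .
  qed
  then have "{z \<in> space std_normal_distribution. t < x * exp (sqrt b * z)}
      = space std_normal_distribution - {..s}"
    by (simp only: set_eq_iff Diff_iff atMost_iff mem_Collect_eq not_le simp_thms)
  then show ?thesis
    using True N.prob_compl[of "{..s}"] by (simp add: K_LN_def cdf_def2 s_def)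
next
  case False
  interpret N: real_distribution std_normal_distribution by (rule real_dist_normal_dist)
  have "t < x * exp (sqrt b * z)" for z
    using False assms by (intro le_less_trans[of t 0]) auto
  then show ?thesis using False N.prob_space by (simp add: K_LN_def)
qed

text \<open>As \<open>exp\<close> is increasing, the inequality holds for the minimum exactly when
  it holds for both coordinates, so the event is the square \<open>?A \<times> ?A\<close> and its
  measure factors.\<close>

lemma K_LN_square_eq_prob:
  assumes "x > 0" "b > 0"
  shows "(K_LN t (ln x) (sqrt b))\<^sup>2
    = measure std_normal_pair {z \<in> space std_normal_pair. t < x * exp (sqrt b * (case z of (u, v) \<Rightarrow> min u v))}"
proof -
  interpret N: prob_space std_normal_distribution
    by (rule prob_space_normal_density) simp
  let ?A = "{z \<in> space std_normal_distribution. t < x * exp (sqrt b * z)}"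
  have "t < x * exp (sqrt b * min u v) \<longleftrightarrow> t < x * exp (sqrt b * u) \<and> t < x * exp (sqrt b * v)" for u v
  proof -
    have "x * exp (sqrt b * u) \<le> x * exp (sqrt b * v) \<longleftrightarrow> u \<le> v"
      using assms by simp
    then show ?thesis by (cases "u \<le> v") (simp_all add: min_def, linarith+)
  qed
  then have "{z \<in> space std_normal_pair. t < x * exp (sqrt b * (case z of (u, v) \<Rightarrow> min u v))} = ?A \<times> ?A"
    by (auto simp: space_pair_measure)
  moreover have "emeasure std_normal_pair (?A \<times> ?A)
      = emeasure std_normal_distribution ?A * emeasure std_normal_distribution ?A"
    by (rule N.emeasure_pair_measure_Times) measurable
  then have "measure std_normal_pair (?A \<times> ?A)
      = measure std_normal_distribution ?A * measure std_normal_distribution ?A"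
    by (simp only: measure_def enn2real_mult)
  ultimately show ?thesis
    by (simp only: K_LN_eq_prob[OF assms] power2_eq_square)
qed

section \<open>Minimisation of the leading terms of the MSE\<close>

text \<open>In the variable \<open>r = sqrt b\<close> the function is the quartic
  \<open>A - k * r + d * r ^ 4\<close>, whose excess over its value at the stationary point factors
  into visibly nonnegative terms.\<close>

lemma arg_min_sqrt_quadratic:
  fixes A k d :: real
  assumes k: "k > 0" and d: "d > 0"
  shows "is_arg_min (\<lambda>b. A - k * sqrt b + b\<^sup>2 * d) (\<lambda>b. b > 0) b \<longleftrightarrow> b = (4 * d / k) powr (- 2 / 3)"
    and "A - k * sqrt ((4 * d / k) powr (- 2 / 3)) + ((4 * d / k) powr (- 2 / 3))\<^sup>2 * d
           = A - 3 / 4 * (k ^ 4 / (4 * d)) powr (1 / 3)"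
proof -
  let ?g = "\<lambda>b. A - k * sqrt b + b\<^sup>2 * d"
  \<comment> \<open>The positive root of \<open>4 * d * s ^ 3 = k\<close>, the stationarity
    condition in the variable \<open>sqrt b\<close>; the minimiser is therefore
    \<open>s\<^sup>2\<close>.\<close>
  define s where "s = (k / (4 * d)) powr (1 / 3)"
  have s0: "s > 0" using k d by (simp add: s_def)
  have "s ^ 3 = k / (4 * d)"
    using k d unfolding s_def by (subst powr_power) simp_all
  then have ks: "k = 4 * d * s ^ 3" using d by (simp add: field_simps)
  have "(4 * d / k) powr (- 2 / 3) = (inverse (k / (4 * d))) powr (- (2 / 3))"
    by simp
  also have "\<dots> = (k / (4 * d)) powr (2 / 3)"
    using k d by (subst inverse_powr) (simp_all add: powr_minus)
  also have "\<dots> = s\<^sup>2"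
    using k d unfolding s_def by (subst powr_power) simp_all
  finally have b0: "(4 * d / k) powr (- 2 / 3) = s\<^sup>2" .
  have gs: "?g (s\<^sup>2) = A - 3 * d * s ^ 4"
    using s0 by (simp add: ks algebra_simps power_numeral_reduce)
  \<comment> \<open>With \<open>k\<close> eliminated this is the identity
    \<open>r^4 - 4 s^3 r + 3 s^4 = (r - s)^2 ((r + s)^2 + 2 s^2)\<close>. The last factor is
    positive, which makes the minimiser unique.\<close>
  have diff: "?g b = ?g (s\<^sup>2) + d * ((sqrt b - s)\<^sup>2 * ((sqrt b + s)\<^sup>2 + 2 * s\<^sup>2))" if "b > 0" for b
  proof -
    obtain r where r: "r > 0" "b = r\<^sup>2"
      using \<open>b > 0\<close> by (metis real_sqrt_gt_zero real_sqrt_pow2 less_imp_le)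
    then show ?thesis using s0
      by (simp add: ks power2_eq_square power4_eq_xxxx power3_eq_cube) (simp add: algebra_simps)
  qed
  have min: "?g (s\<^sup>2) < ?g b" if "b > 0" "b \<noteq> s\<^sup>2" for b
  proof -
    have "sqrt b \<noteq> s" using that by auto
    then have "0 < (sqrt b - s)\<^sup>2 * ((sqrt b + s)\<^sup>2 + 2 * s\<^sup>2)"
      using s0 by (intro mult_pos_pos add_nonneg_pos) auto
    then show ?thesis using d diff[OF that(1)] by simp
  qed
  show "is_arg_min ?g (\<lambda>b. b > 0) b \<longleftrightarrow> b = (4 * d / k) powr (- 2 / 3)"
    unfolding b0 is_arg_min_def
  proof
    assume *: "0 < b \<and> (\<nexists>y. 0 < y \<and> ?g y < ?g b)"
    moreover have "0 < s\<^sup>2" using s0 by simp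
    ultimately show "b = s\<^sup>2" using min by blast
  next
    assume b: "b = s\<^sup>2"
    have "\<not> ?g y < ?g b" if "0 < y" for y
      using min[OF that] b by (cases "y = s\<^sup>2") force+
    then show "0 < b \<and> (\<nexists>y. 0 < y \<and> ?g y < ?g b)" using b s0 by auto
  qed
  \<comment> \<open>Writing the quantity as a cube makes its cube root \<open>4 * d * s ^ 4\<close>,
    and three quarters of that is the drop \<open>3 * d * s ^ 4\<close> found in
    \<open>gs\<close>.\<close>
  have "k ^ 4 / (4 * d) = (4 * d * s ^ 4) ^ 3"
    using d unfolding ks by (simp add: power_mult_distrib power_mult[symmetric] eval_nat_numeral)
  then have "(k ^ 4 / (4 * d)) powr (1 / 3) = ((4 * d * s ^ 4) powr 3) powr (1 / 3)"
    using d s0 by simp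
  also have "\<dots> = 4 * d * s ^ 4"
    using d s0 unfolding powr_powr by simp
  finally show "?g ((4 * d / k) powr (- 2 / 3)) = A - 3 / 4 * (k ^ 4 / (4 * d)) powr (1 / 3)"
    unfolding b0 gs by simp
qed

section \<open>Moments of the kernel and of averages\<close>

lemma K_LN_bounds: "0 \<le> K_LN t \<mu> \<sigma>" "K_LN t \<mu> \<sigma> \<le> 1"
proof -
  interpret real_distribution std_normal_distribution by (rule real_dist_normal_dist)
  show "0 \<le> K_LN t \<mu> \<sigma>" "K_LN t \<mu> \<sigma> \<le> 1"
    using cdf_nonneg cdf_bounded_prob by (auto simp: K_LN_def)
qed

lemma K_LN_measurable [measurable]: "(\<lambda>t. K_LN t \<mu> \<sigma>) \<in> borel_measurable borel"
proof -
  interpret real_distribution std_normal_distribution by (rule real_dist_normal_dist)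
  have [measurable]: "cdf std_normal_distribution \<in> borel_measurable borel"
    by (intro borel_measurable_mono monoI cdf_nondecreasing)
  show ?thesis unfolding K_LN_def by measurable
qed

lemma (in prob_space) MSE_eq_variance_plus_bias:
  assumes "integrable M Y" "integrable M (\<lambda>\<omega>. (Y \<omega>)\<^sup>2)"
  shows "MSE M Y \<theta> = variance Y + (Bias M Y \<theta>)\<^sup>2"
  unfolding variance_eq[OF assms] MSE_def Bias_def
  using assms by (simp add: power2_diff prob_space algebra_simps)

text \<open>Under the law of \<open>X\<close> the kernel and its square are tail probabilities, so
  \<open>integral_tail_prob_eq_integral_cdf\<close> moves the average from the observation to the
  Gaussian variables. All evaluation points of \<open>F\<close> are positive, where \<open>F\<close>
  is continuous.\<close>

lemma (in prob_space) K_LN_moments: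
  fixes X :: "'a \<Rightarrow> real"
  assumes X: "random_variable borel X"
    and F: "cdf (distr M borel X) = F" and cont: "\<And>y. y > 0 \<Longrightarrow> isCont F y"
    and x: "x > 0" and b: "b > 0"
  shows "expectation (\<lambda>\<omega>. K_LN (X \<omega>) (ln x) (sqrt b))
      = (\<integral>z. F (x * exp (sqrt b * z)) \<partial>std_normal_distribution)"
    and "expectation (\<lambda>\<omega>. (K_LN (X \<omega>) (ln x) (sqrt b))\<^sup>2)
      = (\<integral>z. F (x * exp (sqrt b * (case z of (u, v) \<Rightarrow> min u v))) \<partial>std_normal_pair)"
proof -
  interpret D: real_distribution "distr M borel X" using X by simp
  interpret P: pair_prob_space std_normal_distribution std_normal_distribution
    by (rule pair_prob_space_std_normal)
  have pos: "x * exp (sqrt b * z) > 0" for z using x by simp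
  have m1: "(\<lambda>z. x * exp (sqrt b * z)) \<in> borel_measurable std_normal_distribution" by simp
  have m2: "(\<lambda>z. x * exp (sqrt b * (case z of (u, v) \<Rightarrow> min u v))) \<in> borel_measurable std_normal_pair" by simp
  have "expectation (\<lambda>\<omega>. K_LN (X \<omega>) (ln x) (sqrt b))
      = (\<integral>t. K_LN t (ln x) (sqrt b) \<partial>distr M borel X)"
    using X by (simp add: integral_distr)
  also have "\<dots> = (\<integral>z. F (x * exp (sqrt b * z)) \<partial>std_normal_distribution)"
    unfolding K_LN_eq_prob[OF x b]
    using integral_tail_prob_eq_integral_cdf[OF D.real_distribution_axioms
        P.M1.prob_space_axioms m1] cont pos F by simp
  finally show "expectation (\<lambda>\<omega>. K_LN (X \<omega>) (ln x) (sqrt b))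
      = (\<integral>z. F (x * exp (sqrt b * z)) \<partial>std_normal_distribution)" .
  have "expectation (\<lambda>\<omega>. (K_LN (X \<omega>) (ln x) (sqrt b))\<^sup>2)
      = (\<integral>t. (K_LN t (ln x) (sqrt b))\<^sup>2 \<partial>distr M borel X)"
    using X by (simp add: integral_distr)
  also have "\<dots> = (\<integral>z. F (x * exp (sqrt b * (case z of (u, v) \<Rightarrow> min u v))) \<partial>std_normal_pair)"
    unfolding K_LN_square_eq_prob[OF x b]
    using integral_tail_prob_eq_integral_cdf[OF D.real_distribution_axioms
        P.prob_space_axioms m2] cont pos F by simp
  finally show "expectation (\<lambda>\<omega>. (K_LN (X \<omega>) (ln x) (sqrt b))\<^sup>2)
      = (\<integral>z. F (x * exp (sqrt b * (case z of (u, v) \<Rightarrow> min u v))) \<partial>std_normal_pair)" .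
qed

text \<open>Boundedness supplies every integrability condition; by independence the variances of the
  summands add, and the factor \<open>1 / real n\<close> enters squared.\<close>

lemma (in prob_space) average_moments:
  fixes Y :: "nat \<Rightarrow> 'a \<Rightarrow> real"
  assumes ind: "indep_vars (\<lambda>_. borel) Y {1..n}"
    and bdd: "\<And>i \<omega>. \<bar>Y i \<omega>\<bar> \<le> B"
    and m: "\<And>i. i \<in> {1..n} \<Longrightarrow> expectation (Y i) = m"
    and s: "\<And>i. i \<in> {1..n} \<Longrightarrow> expectation (\<lambda>\<omega>. (Y i \<omega>)\<^sup>2) = s"
    and n: "n \<ge> 1"
  defines "A \<equiv> \<lambda>\<omega>. 1 / real n * (\<Sum>i=1..n. Y i \<omega>)"
  shows "integrable M A" "integrable M (\<lambda>\<omega>. (A \<omega>)\<^sup>2)"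
    and "expectation A = m" "variance A = 1 / real n * (s - m\<^sup>2)"
proof -
  have [measurable]: "random_variable borel (Y i)" if "i \<in> {1..n}" for i
    using ind that by (auto simp: indep_vars_def)
  have int: "integrable M (Y i)" "integrable M (\<lambda>\<omega>. (Y i \<omega>)\<^sup>2)" if "i \<in> {1..n}" for i
  proof -
    show "integrable M (Y i)"
      using that bdd by (intro integrable_const_bound[of _ B]) auto
    have "(Y i \<omega>)\<^sup>2 \<le> B\<^sup>2" for \<omega>
      using power_mono[OF bdd[of i \<omega>], of 2] by simp
    then show "integrable M (\<lambda>\<omega>. (Y i \<omega>)\<^sup>2)"
      using that by (intro integrable_const_bound[of _ "B\<^sup>2"]) auto
  qed
  have iS: "integrable M (\<lambda>\<omega>. \<Sum>i=1..n. Y i \<omega>)" using int by auto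
  have S: "integrable M (\<lambda>\<omega>. (\<Sum>i=1..n. Y i \<omega>)\<^sup>2)"
    "variance (\<lambda>\<omega>. \<Sum>i=1..n. Y i \<omega>) = (\<Sum>i=1..n. variance (Y i))"
    using variance_sum_indep[OF _ ind int(2)] by auto
  show A: "integrable M A" "integrable M (\<lambda>\<omega>. (A \<omega>)\<^sup>2)"
    unfolding A_def power_mult_distrib using iS S(1) by auto
  show EA: "expectation A = m"
    unfolding A_def using int n m by simp
  have "variance (Y i) = s - m\<^sup>2" if "i \<in> {1..n}" for i
    using variance_eq[OF int[OF that]] m[OF that] s[OF that] by simp
  then have V: "variance (\<lambda>\<omega>. \<Sum>i=1..n. Y i \<omega>) = real n * (s - m\<^sup>2)"
    unfolding S(2) by simp
  have "variance A = (\<integral>\<omega>. (1 / real n)\<^sup>2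
      * ((\<Sum>i=1..n. Y i \<omega>) - expectation (\<lambda>\<omega>. \<Sum>i=1..n. Y i \<omega>))\<^sup>2 \<partial>M)"
    unfolding A_def by (simp add: power_mult_distrib[symmetric] right_diff_distrib)
  also have "\<dots> = (1 / real n)\<^sup>2 * variance (\<lambda>\<omega>. \<Sum>i=1..n. Y i \<omega>)"
    by (rule integral_mult_right_zero)
  finally have "variance A = (1 / real n)\<^sup>2 * variance (\<lambda>\<omega>. \<Sum>i=1..n. Y i \<omega>)" .
  then show "variance A = 1 / real n * (s - m\<^sup>2)"
    unfolding V using n by (simp add: power2_eq_square)
qed

section \<open>Bias and variance expansions of the estimator\<close>

text \<open>The bias is a function \<open>\<beta>\<close> of \<open>b\<close> alone because the
  observations are identically distributed, and \<open>C\<close> is uniform in \<open>n\<close> and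
  \<open>b\<close>. This uniformity allows the constant to be fixed before any sequence of smoothing
  parameters and the same bounds to be reused at the optimal \<open>b\<close>.\<close>

lemma (in prob_space) LN_expansion:
  fixes X :: "nat \<Rightarrow> 'a \<Rightarrow> real" and F f f' :: "real \<Rightarrow> real"
  assumes ind: "indep_vars (\<lambda>_. borel) X {1..}"
    and cdf: "\<And>i. i \<ge> 1 \<Longrightarrow> cdf (distr M borel (X i)) = F"
    and F': "\<And>y. y > 0 \<Longrightarrow> (F has_real_derivative f y) (at y)"
    and f': "(f has_real_derivative f' x) (at x)"
    and x: "x > 0"
  obtains C and \<beta> :: "real \<Rightarrow> real"
  where "C \<ge> 0"
    and "((\<lambda>b. \<beta> b / b) \<longlongrightarrow> x / 2 * (f x + x * f' x)) (at_right 0)"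
    and "\<And>n b. n \<ge> 1 \<Longrightarrow> b > 0 \<Longrightarrow> MSE M (F_hat_LN X n b x) (F x)
      = variance (F_hat_LN X n b x) + (Bias M (F_hat_LN X n b x) (F x))\<^sup>2"
    and "\<And>n b. n \<ge> 1 \<Longrightarrow> b > 0 \<Longrightarrow> Bias M (F_hat_LN X n b x) (F x) = \<beta> b"
    and "\<And>n b. n \<ge> 1 \<Longrightarrow> b > 0 \<Longrightarrow>
      \<bar>variance (F_hat_LN X n b x)
        - (1 / real n * (F x * (1 - F x)) - 1 / real n * sqrt b * (x * f x / sqrt pi))\<bar>
      \<le> C * (1 / real n * b)"
proof -
  let ?N = std_normal_distribution
  interpret N: real_distribution ?N by (rule real_dist_normal_dist)
  interpret P: pair_prob_space ?N ?N by (rule pair_prob_space_std_normal)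
  have rv[measurable]: "random_variable borel (X i)" if "i \<ge> 1" for i
    using ind that by (auto simp: indep_vars_def)
  interpret D: real_distribution "distr M borel (X 1)" using rv[of 1] by simp
  have F: "F = Distribution_Functions.cdf (distr M borel (X 1))" using cdf[of 1] by simp
  have F01: "0 \<le> F y" "F y \<le> 1" for y
    unfolding F by (rule D.cdf_nonneg, rule D.cdf_bounded_prob)
  have contF: "isCont F y" if "y > 0" for y using F'[OF that] by (rule DERIV_isCont)
  have [measurable]: "F \<in> borel_measurable borel"
    unfolding F by (intro borel_measurable_mono monoI D.cdf_nondecreasing)

  \<comment> \<open>On the logarithmic scale both moments are averages of this one function. Its
    first two derivatives at 0, \<open>x * f x\<close> and \<open>x * (f x + x * f' x)\<close>, give
    the coefficients of the expansion.\<close>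
  define h where "h u = F (x * exp u)" for u
  define h' where "h' u = f (x * exp u) * (x * exp u)" for u
  have h0: "h 0 = F x" "h' 0 = x * f x" by (simp_all add: h_def h'_def)
  have [measurable]: "h \<in> borel_measurable borel" unfolding h_def by measurable
  have dh: "(h has_real_derivative h' u) (at u)" for u
  proof -
    have "((\<lambda>u. x * exp u) has_real_derivative x * exp u) (at u)"
      by (auto intro!: derivative_eq_intros)
    from DERIV_chain2[OF F' this] show ?thesis
      using x by (simp add: h_def[abs_def] h'_def)
  qed
  have dh': "(h' has_real_derivative x * (f x + x * f' x)) (at 0)"
  proof -
    have e: "((\<lambda>u. x * exp u) has_real_derivative x) (at 0)"
      by (auto intro!: derivative_eq_intros)
    have "((\<lambda>u. f (x * exp u)) has_real_derivative f' x * x) (at 0)"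
      using e f' by (intro DERIV_chain2[where g = "\<lambda>u. x * exp u" and f = f]) simp_all
    from DERIV_mult[OF this e] show ?thesis
      unfolding h'_def by (simp add: algebra_simps)
  qed
  have "\<forall>\<^sub>F u in nhds 0. (h has_real_derivative h' u) (at u)" using dh by simp
  note lim0 = second_order_expansion[OF this dh']
  have lim: "((\<lambda>u. (h u - F x - x * f x * u) / u\<^sup>2) \<longlongrightarrow> x * (f x + x * f' x) / 2) (at 0)"
    using lim0 unfolding h0 .
  have "\<bar>h u\<bar> \<le> 1" for u using F01 by (simp add: h_def)
  from bounded_quadratic_remainder[OF lim0 this]
  obtain B where B: "\<bar>h u - F x - x * f x * u\<bar> \<le> B * u\<^sup>2" for u
    unfolding h0 by blast
  have B0: "B \<ge> 0" using B[of 1] by simp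

  let ?W = "\<lambda>(u, v). min u v :: real"
  let ?V = "\<integral>z. (?W z)\<^sup>2 \<partial>std_normal_pair"
  define m where "m b = (\<integral>z. h (sqrt b * z) \<partial>?N)" for b
  define s where "s b = (\<integral>z. h (sqrt b * ?W z) \<partial>std_normal_pair)" for b
  have N1: "(\<integral>z. z \<partial>?N) = 0" and N2: "integrable ?N (\<lambda>z. z\<^sup>2)" "(\<integral>z. z\<^sup>2 \<partial>?N) = 1"
    using integral_std_normal_distribution_moment_odd[of 1]
      std_normal_distribution_even_moments[of 1] by simp_all
  have W2: "integrable std_normal_pair (\<lambda>z. (?W z)\<^sup>2)"
    using min_std_normal_integrable_square by (simp add: case_prod_unfold)
  \<comment> \<open>A standard normal variable has mean 0, so the first moment has no term of order
    \<open>sqrt b\<close>.\<close>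
  have m_bound: "\<bar>m b - F x\<bar> \<le> B * b" if "b > 0" for b
    using N.expectation_small_scale(2)[of "\<lambda>z. z" h "F x" "x * f x" B "sqrt b"] B N1 N2 that
    unfolding m_def by simp
  \<comment> \<open>The mean \<open>- 1 / sqrt pi\<close> of the minimum is the origin of the
    negative \<open>sqrt b\<close> term in the variance.\<close>
  have s_bound: "\<bar>s b - F x + sqrt b * (x * f x / sqrt pi)\<bar> \<le> B * b * ?V" if "b > 0" for b
    using P.expectation_small_scale(2)[of ?W h "F x" "x * f x" B "sqrt b"] B W2 that
    unfolding s_def by (simp add: expectation_min_std_normal mult.commute)
  have m01: "0 \<le> m b" "m b \<le> 1" for b
  proof -
    show "0 \<le> m b" unfolding m_def h_def by (intro Bochner_Integration.integral_nonneg) (simp add: F01)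
    have "m b \<le> (\<integral>z. 1 \<partial>?N)"
      unfolding m_def h_def using F01
      by (intro integral_mono N.integrable_const_bound[of _ 1]) auto
    then show "m b \<le> 1" using N.prob_space by simp
  qed
  have m_lim: "((\<lambda>b. (m b - F x) / b) \<longlongrightarrow> x / 2 * (f x + x * f' x)) (at_right 0)"
  proof -
    \<comment> \<open>The limit is available in the scale \<open>s = sqrt b\<close>; this
      substitution turns division by \<open>s\<^sup>2\<close> into division by
      \<open>b\<close>.\<close>
    have sq: "filterlim sqrt (at 0) (at_right 0)"
      unfolding filterlim_at
      by (auto intro!: tendsto_eq_intros simp: eventually_at_filter)
    have "((\<lambda>s. ((\<integral>z. h (s * z) \<partial>?N) - F x) / s\<^sup>2) \<longlongrightarrow> x / 2 * (f x + x * f' x)) (at 0)"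
      using N.expectation_small_scale_limit[of "\<lambda>z. z" h "F x" "x * f x" B, OF _ _ _ B lim] N1 N2
      by simp
    from filterlim_compose[OF this sq] show ?thesis
      by (rule Lim_transform_eventually) (auto simp: eventually_at_filter m_def)
  qed

  have avg: "integrable M (F_hat_LN X n b x)" "integrable M (\<lambda>\<omega>. (F_hat_LN X n b x \<omega>)\<^sup>2)"
    "expectation (F_hat_LN X n b x) = m b"
    "variance (F_hat_LN X n b x) = 1 / real n * (s b - (m b)\<^sup>2)" if "n \<ge> 1" "b > 0" for n b
  proof -
    let ?Y = "\<lambda>i \<omega>. K_LN (X i \<omega>) (ln x) (sqrt b)"
    have Y: "indep_vars (\<lambda>_. borel) ?Y {1..n}"
      by (rule indep_vars_compose2[OF indep_vars_subset[OF ind]]) auto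
    have bd: "\<bar>?Y i \<omega>\<bar> \<le> 1" for i \<omega> using K_LN_bounds by simp
    have em: "expectation (?Y i) = m b" "expectation (\<lambda>\<omega>. (?Y i \<omega>)\<^sup>2) = s b" if "i \<in> {1..n}" for i
      using K_LN_moments[OF rv cdf contF x \<open>b > 0\<close>, of i] that
      by (simp_all add: m_def s_def h_def)
    have "F_hat_LN X n b x = (\<lambda>\<omega>. 1 / real n * (\<Sum>i=1..n. ?Y i \<omega>))"
      by (rule ext) (rule F_hat_LN_def)
    then show "integrable M (F_hat_LN X n b x)" "integrable M (\<lambda>\<omega>. (F_hat_LN X n b x \<omega>)\<^sup>2)"
      "expectation (F_hat_LN X n b x) = m b"
      "variance (F_hat_LN X n b x) = 1 / real n * (s b - (m b)\<^sup>2)"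
      using average_moments[OF Y bd em \<open>n \<ge> 1\<close>] by simp_all
  qed

  show thesis
  \<comment> \<open>\<open>B * ?V\<close> bounds the error of the second moment.
    \<open>2 * B\<close> bounds the effect of replacing \<open>(m b)\<^sup>2\<close> by
    \<open>(F x)\<^sup>2\<close>, as \<open>F x\<close> and \<open>m b\<close> lie between 0 and 1
    and differ by at most \<open>B * b\<close>.\<close>
  proof (rule that[of "B * ?V + 2 * B" "\<lambda>b. m b - F x"])
    have "?V \<ge> 0" by (intro Bochner_Integration.integral_nonneg) simp
    then show "B * ?V + 2 * B \<ge> 0" using B0 by simp
    show "((\<lambda>b. (m b - F x) / b) \<longlongrightarrow> x / 2 * (f x + x * f' x)) (at_right 0)" by (rule m_lim)
    fix n :: nat and b :: real assume nb: "n \<ge> 1" "b > 0"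
    show "MSE M (F_hat_LN X n b x) (F x)
        = variance (F_hat_LN X n b x) + (Bias M (F_hat_LN X n b x) (F x))\<^sup>2"
      by (rule MSE_eq_variance_plus_bias) (rule avg[OF nb])+
    show "Bias M (F_hat_LN X n b x) (F x) = m b - F x"
      unfolding Bias_def avg[OF nb] ..
    have "\<bar>(F x)\<^sup>2 - (m b)\<^sup>2\<bar> = \<bar>F x + m b\<bar> * \<bar>m b - F x\<bar>"
      by (simp add: abs_mult[symmetric] power2_eq_square algebra_simps abs_minus_commute)
    also have "\<dots> \<le> 2 * (B * b)"
      using F01[of x] m01[of b] m_bound[OF nb(2)] by (intro mult_mono) auto
    finally have "\<bar>(s b - F x + sqrt b * (x * f x / sqrt pi)) + ((F x)\<^sup>2 - (m b)\<^sup>2)\<bar>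
        \<le> (B * ?V + 2 * B) * b"
      using s_bound[OF nb(2)] by (simp add: algebra_simps)
    then have "1 / real n * \<bar>(s b - F x + sqrt b * (x * f x / sqrt pi)) + ((F x)\<^sup>2 - (m b)\<^sup>2)\<bar>
        \<le> 1 / real n * ((B * ?V + 2 * B) * b)"
      by (rule mult_left_mono) simp
    moreover have "1 / real n * (s b - (m b)\<^sup>2)
          - (1 / real n * (F x * (1 - F x)) - 1 / real n * sqrt b * (x * f x / sqrt pi))
        = 1 / real n * ((s b - F x + sqrt b * (x * f x / sqrt pi)) + ((F x)\<^sup>2 - (m b)\<^sup>2))"
      using nb(1) by (simp add: field_simps power2_eq_square)
    ultimately show "\<bar>variance (F_hat_LN X n b x)
        - (1 / real n * (F x * (1 - F x)) - 1 / real n * sqrt b * (x * f x / sqrt pi))\<bar>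
      \<le> (B * ?V + 2 * B) * (1 / real n * b)"
      unfolding avg(4)[OF nb] by (simp add: abs_mult mult_ac)
  qed
qed

section \<open>MSE expansion and the optimal smoothing parameter\<close>

text \<open>A negative derivative would make \<open>F\<close> drop immediately to the right of
  \<open>y\<close>. This gives the sign of \<open>f x\<close>, on which the existence of a minimiser
  rests.\<close>

lemma mono_has_real_derivative_nonneg:
  fixes F :: "real \<Rightarrow> real"
  assumes "mono F" "(F has_real_derivative D) (at y)"
  shows "D \<ge> 0"
proof (rule ccontr)
  assume "\<not> D \<ge> 0"
  then obtain d where d: "d > 0" "\<And>h. h > 0 \<Longrightarrow> h < d \<Longrightarrow> F (y + h) < F y"
    using DERIV_neg_dec_right[OF assms(2)] by auto
  then have "F (y + d / 2) < F y" by simp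
  moreover have "F y \<le> F (y + d / 2)" using d(1) by (intro monoD[OF assms(1)]) simp
  ultimately show False by simp
qed

text \<open>\<open>C\<close> is fixed before \<open>b\<close> because the constant in O_x may not
  depend on the sequence; \<open>R1\<close> and \<open>R2\<close> are the O_x and o_x terms. The
  equivalence for the minimiser expresses its uniqueness as well.\<close>

theorem corollary6p2:
  fixes M :: "'a measure" and X :: "nat \<Rightarrow> 'a \<Rightarrow> real"
    and F f f' :: "real \<Rightarrow> real" and x :: real
  assumes "prob_space M"
    and "prob_space.indep_vars M (\<lambda>_. borel) X {1..}"
    and "\<forall>i\<ge>1. cdf (distr M borel (X i)) = F"
    and "\<forall>y<0. F y = 0"
    and "\<forall>y\<ge>0. (F has_real_derivative f y) (at y within {0..})"
    and "\<forall>y\<ge>0. (f has_real_derivative f' y) (at y within {0..})"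
    and "continuous_on {0..} f" and "continuous_on {0..} f'"
    and "bounded (f ` {0..})" and "bounded (f' ` {0..})"
    and "x > 0"
  shows
    "(\<exists>C::real. \<forall>b :: nat \<Rightarrow> real. (\<forall>n. b n > 0) \<longrightarrow> b \<longlonglongrightarrow> 0 \<longrightarrow>
        (\<forall>n\<ge>1. MSE M (F_hat_LN X n (b n) x) (F x) =
            prob_space.variance M (F_hat_LN X n (b n) x) + (Bias M (F_hat_LN X n (b n) x) (F x))\<^sup>2) \<and>
        (\<exists>R1 R2 :: nat \<Rightarrow> real.
            (\<forall>n\<ge>1. MSE M (F_hat_LN X n (b n) x) (F x) = AMSE_LN F f f' x n (b n) + R1 n + R2 n) \<and>
            limsup (\<lambda>n. ereal \<bar>R1 n / (1 / real n * b n)\<bar>) < ereal C \<and>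
            R2 \<in> o(\<lambda>n. (b n)\<^sup>2))) \<and>
     (f x * (f x + x * f' x) \<noteq> 0 \<longrightarrow>
        (\<forall>n\<ge>1. \<forall>b. is_arg_min (AMSE_LN F f f' x n) (\<lambda>b. b > 0) b \<longleftrightarrow> b = b_opt_LN f f' x n) \<and>
        (\<lambda>n. MSE M (F_hat_LN X n (b_opt_LN f f' x n) x) (F x)
              - (1 / real n * (F x * (1 - F x))
                 - real n powr (- 4 / 3) * (3 / 4)
                   * ((x * f x / sqrt pi) ^ 4 / (4 * (x\<^sup>2 / 4 * (f x + x * f' x)\<^sup>2))) powr (1 / 3)))
          \<in> o(\<lambda>n. real n powr (- 4 / 3)))"
proof -
  interpret prob_space M by fact
  have at: "at y within {0..} = at y" if "y > 0" for y :: real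
    using that by (intro at_within_interior) (simp add: interior_Ici[of 0])
  have F': "(F has_real_derivative f y) (at y)" if "y > 0" for y
    using assms(5) that at[OF that] by (metis less_imp_le)
  have f': "(f has_real_derivative f' x) (at x)"
    using assms(6,11) at by (metis less_imp_le)
  define d where "d = x\<^sup>2 / 4 * (f x + x * f' x)\<^sup>2"
  define c where "c = x * f x / sqrt pi"
  define A where "A = F x * (1 - F x)"
  have AMSE: "AMSE_LN F f f' x n b = 1 / real n * A - 1 / real n * sqrt b * c + b\<^sup>2 * d" for n b
    by (simp add: AMSE_LN_def A_def c_def d_def)
  have cdfF: "cdf (distr M borel (X i)) = F" if "i \<ge> 1" for i using assms(3) that by blast
  obtain C \<beta> where C: "C \<ge> 0"
    and \<beta>: "((\<lambda>b. \<beta> b / b) \<longlongrightarrow> x / 2 * (f x + x * f' x)) (at_right 0)"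
    and split: "\<And>n b. n \<ge> 1 \<Longrightarrow> b > 0 \<Longrightarrow> MSE M (F_hat_LN X n b x) (F x)
      = variance (F_hat_LN X n b x) + (Bias M (F_hat_LN X n b x) (F x))\<^sup>2"
    and bias: "\<And>n b. n \<ge> 1 \<Longrightarrow> b > 0 \<Longrightarrow> Bias M (F_hat_LN X n b x) (F x) = \<beta> b"
    and var: "\<And>n b. n \<ge> 1 \<Longrightarrow> b > 0 \<Longrightarrow>
      \<bar>variance (F_hat_LN X n b x)
        - (1 / real n * (F x * (1 - F x)) - 1 / real n * sqrt b * (x * f x / sqrt pi))\<bar>
      \<le> C * (1 / real n * b)"
    by (rule LN_expansion[where X = X and F = F and f = f and f' = f' and x = x,
          OF assms(2) cdfF F' f' \<open>x > 0\<close>]) blast+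
  note var = var[folded A_def c_def]
  \<comment> \<open>The error made by replacing the squared bias with its leading term; it is of
    smaller order than \<open>b\<^sup>2\<close> because \<open>\<beta> b / b\<close> tends to a
    number whose square is \<open>d\<close>.\<close>
  define \<rho> where "\<rho> b = (\<beta> b)\<^sup>2 - b\<^sup>2 * d" for b
  have \<rho>: "((\<lambda>b. \<rho> b / b\<^sup>2) \<longlongrightarrow> 0) (at_right 0)"
  proof -
    have "((\<lambda>b. (\<beta> b / b)\<^sup>2 - d) \<longlongrightarrow> (x / 2 * (f x + x * f' x))\<^sup>2 - d) (at_right 0)"
      by (intro tendsto_intros \<beta>)
    moreover have "(x / 2 * (f x + x * f' x))\<^sup>2 - d = 0"
      by (simp add: d_def power_mult_distrib power_divide)
    moreover have "\<forall>\<^sub>F b in at_right 0. (\<beta> b / b)\<^sup>2 - d = \<rho> b / b\<^sup>2"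
      by (auto simp: eventually_at_filter \<rho>_def power_divide diff_divide_distrib)
    ultimately show ?thesis by (simp only: Lim_transform_eventually)
  qed
  \<comment> \<open>Positivity is asked only eventually: at \<open>n = 0\<close> the optimal choice
    is 0, since \<open>0 powr a = 0\<close>.\<close>
  have \<rho>_seq: "(\<lambda>n. \<rho> (b n) / (b n)\<^sup>2) \<longlonglongrightarrow> 0"
    if "\<forall>\<^sub>F n in sequentially. b n > 0" "b \<longlonglongrightarrow> 0" for b :: "nat \<Rightarrow> real"
  proof (rule filterlim_compose[OF \<rho>])
    show "filterlim b (at_right 0) sequentially"
      using that by (simp add: filterlim_at_right_to_0 filterlim_at eventually_conj_iff
          eventually_mono[OF that(1)])
  qed
  have rem: "\<bar>MSE M (F_hat_LN X n b x) (F x) - AMSE_LN F f f' x n b - \<rho> b\<bar> \<le> C * (1 / real n * b)"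
    if "n \<ge> 1" "b > 0" for n b
    using var[OF that] unfolding split[OF that] bias[OF that] AMSE \<rho>_def by (simp add: algebra_simps)
  show ?thesis
    unfolding c_def[symmetric] d_def[symmetric] A_def[symmetric] b_opt_LN_def
  proof (intro conjI impI)
    show "\<exists>C::real. \<forall>b :: nat \<Rightarrow> real. (\<forall>n. b n > 0) \<longrightarrow> b \<longlonglongrightarrow> 0 \<longrightarrow>
        (\<forall>n\<ge>1. MSE M (F_hat_LN X n (b n) x) (F x) =
            variance (F_hat_LN X n (b n) x) + (Bias M (F_hat_LN X n (b n) x) (F x))\<^sup>2) \<and>
        (\<exists>R1 R2 :: nat \<Rightarrow> real.
            (\<forall>n\<ge>1. MSE M (F_hat_LN X n (b n) x) (F x) = AMSE_LN F f f' x n (b n) + R1 n + R2 n) \<and>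
            limsup (\<lambda>n. ereal \<bar>R1 n / (1 / real n * b n)\<bar>) < ereal C \<and>
            R2 \<in> o(\<lambda>n. (b n)\<^sup>2))"
    \<comment> \<open>The bound by \<open>C\<close> is not strict, whereas the limsup must lie
      strictly below the constant.\<close>
    proof (intro exI[of _ "C + 1"] allI impI conjI)
      fix b :: "nat \<Rightarrow> real"
      assume b: "\<forall>n. b n > 0" "b \<longlonglongrightarrow> 0"
      show "MSE M (F_hat_LN X n (b n) x) (F x) =
            variance (F_hat_LN X n (b n) x) + (Bias M (F_hat_LN X n (b n) x) (F x))\<^sup>2"
        if "n \<ge> 1" for n using split[OF that] b(1) by blast
      \<comment> \<open>What is left after removing \<open>\<rho>\<close>: precisely the error of
        the variance expansion, which \<open>rem\<close> controls.\<close>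
      define R1 where "R1 n = MSE M (F_hat_LN X n (b n) x) (F x) - AMSE_LN F f f' x n (b n) - \<rho> (b n)" for n
      have "\<bar>R1 n / (1 / real n * b n)\<bar> \<le> C" if "n \<ge> 1" for n
      proof -
        have "1 / real n * b n > 0" using b(1) that by simp
        then show ?thesis
          using rem[OF that, of "b n"] b(1) by (simp only: abs_divide R1_def pos_divide_le_eq abs_of_pos)
      qed
      then have "limsup (\<lambda>n. ereal \<bar>R1 n / (1 / real n * b n)\<bar>) \<le> ereal C"
        by (intro Limsup_bounded eventually_sequentiallyI[of 1]) simp
      then have "limsup (\<lambda>n. ereal \<bar>R1 n / (1 / real n * b n)\<bar>) < ereal (C + 1)"
        by (rule le_less_trans) simp
      moreover have "(\<lambda>n. \<rho> (b n)) \<in> o(\<lambda>n. (b n)\<^sup>2)"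
        using \<rho>_seq[OF always_eventually b(2)] b(1)
        by (intro smalloI_tendsto) (auto intro!: always_eventually simp: less_imp_neq[symmetric])
      ultimately show "\<exists>R1 R2 :: nat \<Rightarrow> real.
            (\<forall>n\<ge>1. MSE M (F_hat_LN X n (b n) x) (F x) = AMSE_LN F f f' x n (b n) + R1 n + R2 n) \<and>
            limsup (\<lambda>n. ereal \<bar>R1 n / (1 / real n * b n)\<bar>) < ereal (C + 1) \<and>
            R2 \<in> o(\<lambda>n. (b n)\<^sup>2)"
        by (intro exI[of _ R1] exI[of _ "\<lambda>n. \<rho> (b n)"]) (simp add: R1_def)
    qed
  next
    assume nz: "f x * (f x + x * f' x) \<noteq> 0"
    \<comment> \<open>The assumption only says that \<open>f x\<close> is nonzero; monotonicity of
      the cdf makes it positive, hence \<open>c > 0\<close>.\<close>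
    have "mono F"
    proof -
      interpret D: real_distribution "distr M borel (X 1)"
        using assms(2) by (auto simp: indep_vars_def)
      show ?thesis using D.cdf_nondecreasing assms(3) by (auto intro!: monoI)
    qed
    then have "f x > 0"
      using mono_has_real_derivative_nonneg[OF _ F'[OF \<open>x > 0\<close>]] nz by fastforce
    then have c: "c > 0" using \<open>x > 0\<close> by (simp add: c_def)
    have d: "d > 0" using nz \<open>x > 0\<close> by (simp add: d_def)
    define K where "K = (4 * d / c) powr (- 2 / 3)"
    define V where "V = (c ^ 4 / (4 * d)) powr (1 / 3)"
    have K: "K > 0" using c d by (simp add: K_def)
    \<comment> \<open>The coefficient of \<open>sqrt b\<close> is \<open>c / real n\<close>; the
      power of \<open>n\<close> separates from the constant \<open>K\<close>.\<close>
    have opt: "(4 * d / (c / real n)) powr (- 2 / 3) = real n powr (- 2 / 3) * K" if "n \<ge> 1" for n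
    proof -
      have "4 * d / (c / real n) = real n * (4 * d / c)" by simp
      then show ?thesis unfolding K_def using c d by (simp only: powr_mult)
    qed
    have AMSE': "AMSE_LN F f f' x n = (\<lambda>b. 1 / real n * A - c / real n * sqrt b + b\<^sup>2 * d)" for n
      by (simp add: AMSE fun_eq_iff)
    show "\<forall>n\<ge>1. \<forall>b. is_arg_min (AMSE_LN F f f' x n) (\<lambda>b. b > 0) b
        \<longleftrightarrow> b = real n powr (- 2 / 3) * (4 * d / c) powr (- 2 / 3)"
      using arg_min_sqrt_quadratic(1)[of "c / real _" d] c d opt
      unfolding AMSE' K_def by simp
    define bo where "bo n = real n powr (- 2 / 3) * K" for n
    have val: "AMSE_LN F f f' x n (bo n) = 1 / real n * A - real n powr (- 4 / 3) * (3 / 4) * V"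
      if "n \<ge> 1" for n
    proof -
      have "(c / real n) ^ 4 / (4 * d) = (1 / real n) ^ 4 * (c ^ 4 / (4 * d))"
        by (simp add: power_divide)
      then have "((c / real n) ^ 4 / (4 * d)) powr (1 / 3) = ((1 / real n) ^ 4) powr (1 / 3) * V"
        unfolding V_def using d by (simp only: powr_mult)
      also have "((1 / real n) ^ 4) powr (1 / 3) = real n powr (- 4 / 3)"
      proof -
        have "(1 / real n) ^ 4 = real n powr (- 4)"
          using that by (simp add: powr_minus power_divide inverse_eq_divide)
        then show ?thesis by (simp only: powr_powr) simp
      qed
      finally show ?thesis
        using arg_min_sqrt_quadratic(2)[of "c / real n" d "1 / real n * A"] c d that
        unfolding AMSE' bo_def opt[OF that] by simp
    qed
    have bo: "bo n > 0" if "n \<ge> 1" for n using that K by (simp add: bo_def)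
    have bo_lim: "bo \<longlonglongrightarrow> 0"
    proof -
      have "(\<lambda>n. real n powr (- 2 / 3)) \<longlonglongrightarrow> 0"
        by (intro tendsto_neg_powr filterlim_real_sequentially) simp
      then show ?thesis unfolding bo_def by (rule tendsto_mult_left_zero)
    qed
    let ?D = "\<lambda>n. MSE M (F_hat_LN X n (bo n) x) (F x)
          - (1 / real n * A - real n powr (- 4 / 3) * (3 / 4) * V)"
    have "(\<lambda>n. ?D n / real n powr (- 4 / 3)) \<longlonglongrightarrow> 0"
    proof (rule Lim_null_comparison)
      \<comment> \<open>At the optimal \<open>b\<close> the term \<open>1 / real n * bo n\<close>
        has order \<open>n powr (- 5 / 3)\<close>, a factor \<open>n powr (- 1 / 3)\<close> below
        the target, while \<open>(bo n)\<^sup>2\<close> has exactly the target order, so there the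
        decay comes from \<open>\<rho>\<close>.\<close>
      show "\<forall>\<^sub>F n in sequentially. norm (?D n / real n powr (- 4 / 3))
          \<le> C * K * real n powr (- 1 / 3) + K\<^sup>2 * \<bar>\<rho> (bo n) / (bo n)\<^sup>2\<bar>"
      proof (rule eventually_sequentiallyI)
        fix n :: nat assume n: "n \<ge> 1"
        let ?p = "real n powr (- 4 / 3)"
        have p: "?p > 0" using n by simp
        have "1 / real n = real n powr (- 1)" using n by (simp add: powr_minus inverse_eq_divide)
        moreover have "real n powr (- 1) * real n powr (- 2 / 3) = real n powr (- 1 / 3) * ?p"
          by (simp only: powr_add[symmetric]) simp
        ultimately have 1: "1 / real n * bo n = K * real n powr (- 1 / 3) * ?p"
          unfolding bo_def by (metis mult.assoc mult.commute)
        have 2: "(bo n)\<^sup>2 = K\<^sup>2 * ?p"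
          by (simp add: bo_def power_mult_distrib power2_eq_square powr_add[symmetric])
        have "\<bar>?D n\<bar> \<le> C * (1 / real n * bo n) + \<bar>\<rho> (bo n)\<bar>"
          using rem[OF n bo[OF n]] unfolding val[OF n] by linarith
        also have "\<bar>\<rho> (bo n)\<bar> = (K\<^sup>2 * \<bar>\<rho> (bo n) / (bo n)\<^sup>2\<bar>) * ?p"
          using K p unfolding 2 by (simp add: abs_divide abs_mult)
        finally have "\<bar>?D n\<bar> \<le> (C * K * real n powr (- 1 / 3) + K\<^sup>2 * \<bar>\<rho> (bo n) / (bo n)\<^sup>2\<bar>) * ?p"
          unfolding 1 by (simp only: distrib_right mult.assoc)
        then show "norm (?D n / ?p)
            \<le> C * K * real n powr (- 1 / 3) + K\<^sup>2 * \<bar>\<rho> (bo n) / (bo n)\<^sup>2\<bar>"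
          unfolding real_norm_def abs_divide using p by (simp only: pos_divide_le_eq abs_of_pos)
      qed
      have "(\<lambda>n. real n powr (- 1 / 3)) \<longlonglongrightarrow> 0"
        by (intro tendsto_neg_powr filterlim_real_sequentially) simp
      moreover have "(\<lambda>n. \<rho> (bo n) / (bo n)\<^sup>2) \<longlonglongrightarrow> 0"
        using bo by (intro \<rho>_seq bo_lim eventually_sequentiallyI[of 1])
      ultimately show "(\<lambda>n. C * K * real n powr (- 1 / 3) + K\<^sup>2 * \<bar>\<rho> (bo n) / (bo n)\<^sup>2\<bar>) \<longlonglongrightarrow> 0"
        by (intro tendsto_add_zero tendsto_mult_right_zero tendsto_rabs_zero)
    qed
    then have "?D \<in> o(\<lambda>n. real n powr (- 4 / 3))"
      by (intro smalloI_tendsto eventually_sequentiallyI[of 1]) auto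
    then show "(\<lambda>n. MSE M (F_hat_LN X n (real n powr (- 2 / 3) * (4 * d / c) powr (- 2 / 3)) x) (F x)
          - (1 / real n * A - real n powr (- 4 / 3) * (3 / 4) * (c ^ 4 / (4 * d)) powr (1 / 3)))
        \<in> o(\<lambda>n. real n powr (- 4 / 3))"
      unfolding bo_def K_def V_def .
  qed
qed

end
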